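(* For every sufficiently large $n$ there is a quantity $p(n)$, depending only on $n$, such that for every Boolean function $f:\{0,1\}^n\to\{0,1\}$ and every integer $l\geq 1$, $$\frac{\mathsf{fmbs}(f^{l})}{\mathsf{mbs}(f^{l})}\leq p(n),$$ that is, $\mathsf{fmbs}(f^l)\le p(n)\,\mathsf{mbs}(f^l)$ (when $\mathsf{mbs}(f^l)=0$ one also has $\mathsf{fmbs}(f^l)=0$). In particular, $p(n)$ does not depend on $l$.
   Context: For $x\in\{0,1\}^n$, $\mathrm{supp}(x)=\{i:x_i=1\}$, and for $B\subseteq[n]$, $x^B$ denotes $x$ with the bits in $B$ flipped. For $f:\{0,1\}^n\to\{0,1\}$ and $x\in\{0,1\}^n$, a monotone sensitive block at $x$ is a nonempty set $B\subseteq[n]\setminus\mathrm{supp}(x)$ with $f(x^B)\neq f(x)$ (equivalently, a sensitive block of the restriction $f_x$ of $f$ to $\{y: y_i=1\ \forall i\in\mathrm{supp}(x)\}$ at the all-zero input). Monotone block sensitivity $\mathsf{mbs}(f,x)$ is the maximum number of pairwise disjoint monotone sensitive blocks at $x$. Fractional monotone block sensitivity $\mathsf{fmbs}(f,x)$ is the optimum of the linear program: maximize $\sum_{B\in W}b_B$ subject to $\sum_{B\in W: i\in B}b_B\le 1$ for all $i\in[n]$ and $b_B\in[0,1]$, where $W$ is the set of monotone sensitive blocks at $x$. $\mathsf{mbs}(f)=\max_x\mathsf{mbs}(f,x)$ and $\mathsf{fmbs}(f)=\max_x\mathsf{fmbs}(f,x)$. Composition: for $f:\{0,1\}^n\to\{0,1\}$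 and $g:\{0,1\}^m\to\{0,1\}$, $(f\circ g)(x^1,\dots,x^n)=f(g(x^1),\dots,g(x^n))$ with $x^i\in\{0,1\}^m$; $f^1=f$ and $f^l=f\circ f^{l-1}$, a function on $n^l$ bits. *)

theory Defs
  imports Complex_Main "HOL-Library.Disjoint_Sets"
begin

text \<open>
  A point of \<open>{0,1}^n\<close> is a Boolean list of length \<open>n\<close>, with coordinates indexed by
  \<open>{..<n}\<close>. A function on \<open>{0,1}^n\<close> is a function on Boolean lists; its values on lists
  of any other length play no role in the definitions below, which take \<open>n\<close> as an argument.
\<close>

definition cube :: "nat \<Rightarrow> bool list set" where
  "cube n = {x. length x = n}"

definition supp :: "bool list \<Rightarrow> nat set" where
  "supp x = {i. i < length x \<and> x ! i}"

definition flip :: "bool list \<Rightarrow> nat set \<Rightarrow> bool list" where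
  "flip x B = map (\<lambda>i. if i \<in> B then \<not> x ! i else x ! i) [0..<length x]"

definition mono_sens_blocks :: "nat \<Rightarrow> (bool list \<Rightarrow> bool) \<Rightarrow> bool list \<Rightarrow> nat set set" where
  "mono_sens_blocks n f x = {B. B \<noteq> {} \<and> B \<subseteq> {..<n} - supp x \<and> f (flip x B) \<noteq> f x}"

definition mbs_at :: "nat \<Rightarrow> (bool list \<Rightarrow> bool) \<Rightarrow> bool list \<Rightarrow> nat" where
  "mbs_at n f x = Max {card P | P. P \<subseteq> mono_sens_blocks n f x \<and> disjoint P}"

definition fmbs_feasible ::
    "nat \<Rightarrow> (bool list \<Rightarrow> bool) \<Rightarrow> bool list \<Rightarrow> (nat set \<Rightarrow> real) \<Rightarrow> bool" where
  "fmbs_feasible n f x b \<longleftrightarrow>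
     (\<forall>i<n. (\<Sum>B\<in>{B \<in> mono_sens_blocks n f x. i \<in> B}. b B) \<le> 1) \<and>
     (\<forall>B\<in>mono_sens_blocks n f x. 0 \<le> b B \<and> b B \<le> 1)"

definition fmbs_at :: "nat \<Rightarrow> (bool list \<Rightarrow> bool) \<Rightarrow> bool list \<Rightarrow> real" where
  "fmbs_at n f x = Sup {(\<Sum>B\<in>mono_sens_blocks n f x. b B) | b. fmbs_feasible n f x b}"

definition mbs :: "nat \<Rightarrow> (bool list \<Rightarrow> bool) \<Rightarrow> nat" where
  "mbs n f = Max (mbs_at n f ` cube n)"

definition fmbs :: "nat \<Rightarrow> (bool list \<Rightarrow> bool) \<Rightarrow> real" where
  "fmbs n f = Max (fmbs_at n f ` cube n)"

text \<open>
  The \<open>i\<close>-th argument \<open>x^i\<close> of the composition is the \<open>i\<close>-th block of \<open>m\<close> consecutive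
  bits of an input of length \<open>n * m\<close>.
\<close>

definition bcomp ::
    "nat \<Rightarrow> nat \<Rightarrow> (bool list \<Rightarrow> bool) \<Rightarrow> (bool list \<Rightarrow> bool) \<Rightarrow> bool list \<Rightarrow> bool" where
  "bcomp n m f g x = f (map (\<lambda>i. g (take m (drop (i * m) x))) [0..<n])"

text \<open>The value at exponent \<open>0\<close> (the identity on one bit) is a convention only.\<close>

fun bpow :: "nat \<Rightarrow> (bool list \<Rightarrow> bool) \<Rightarrow> nat \<Rightarrow> bool list \<Rightarrow> bool" where
  "bpow n f 0 = hd"
| "bpow n f (Suc 0) = f"
| "bpow n f (Suc (Suc l)) = bcomp n (n ^ Suc l) f (bpow n f (Suc l))"

end

theory Submission
  imports Defs
begin

text \<open>
  Let \<open>w\<^sub>l(c)\<close> be the largest monotone block sensitivity of \<open>f^l\<close> at an input of value \<open>c\<close>.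
  A monotone sensitive block of \<open>f \<circ> g\<close> consists of an ordinary sensitive block \<open>S\<close> of \<open>f\<close>
  at the vector \<open>z\<close> of inner values and of one monotone sensitive block of \<open>g\<close> for each
  \<open>i \<in> S\<close>. Hence \<open>w\<^sub>l\<^sub>+\<^sub>1(c)\<close> is the maximum over \<open>f z = c\<close> of an integral packing problem
  for the sensitive blocks of \<open>f\<close> at \<open>z\<close> with capacities \<open>w\<^sub>l(z\<^sub>i)\<close>, and the fractional
  measure obeys the same recursion with its linear relaxation. Rounding down loses at most
  \<open>2^n\<close>.

  If for some value \<open>c\<close> no input of value \<open>c\<close> has two disjoint sensitive blocks, then all these
  linear programs have integral optima and both measures coincide on every iterate. Otherwise
  each of the two numbers \<open>w\<^sub>l(c)\<close> with \<open>l \<ge> 1\<close> is either zero or at least \<open>2^(l-1)\<close>, so the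
  relative rounding losses sum to a convergent geometric series and the ratio of the two
  measures stays below \<open>exp (2 * 2^n)\<close>.
\<close>

section \<open>Flipping and block sensitivity\<close>

lemma length_flip [simp]: "length (flip x B) = length x"
  by (simp add: flip_def)

lemma nth_flip [simp]: "i < length x \<Longrightarrow> flip x B ! i = (x ! i \<noteq> (i \<in> B))"
  by (auto simp: flip_def)

lemma flip_empty [simp]: "flip x {} = x"
  by (rule nth_equalityI) auto

lemma flip_flip: "flip (flip x A) B = flip x (sym_diff A B)"
  by (rule nth_equalityI) auto

lemma flip_flip_disjoint: "A \<inter> B = {} \<Longrightarrow> flip (flip x A) B = flip x (A \<union> B)"
  by (rule nth_equalityI) auto

text \<open>These blocks may flip ones as well as zeros, because raising zeros inside a part can
  move the inner value either way. They are nonempty automatically, since flipping nothing keeps the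
  value.\<close>

definition sens_blocks :: "nat \<Rightarrow> (bool list \<Rightarrow> bool) \<Rightarrow> bool list \<Rightarrow> nat set set" where
  "sens_blocks n f z = {S. S \<subseteq> {..<n} \<and> f (flip z S) \<noteq> f z}"

lemma finite_sens_blocks [simp]: "finite (sens_blocks n f z)"
  by (rule finite_subset[of _ "Pow {..<n}"]) (auto simp: sens_blocks_def)

lemma card_sens_blocks_le: "card (sens_blocks n f z) \<le> 2 ^ n"
proof -
  have "card (sens_blocks n f z) \<le> card (Pow {..<n})"
    by (rule card_mono) (auto simp: sens_blocks_def)
  then show ?thesis by (simp add: card_Pow)
qed

lemma sens_blocks_nonempty: "S \<in> sens_blocks n f z \<Longrightarrow> S \<noteq> {}"
  by (auto simp: sens_blocks_def)

lemma finite_mono_sens_blocks [simp]: "finite (mono_sens_blocks n f x)"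
  by (rule finite_subset[of _ "Pow {..<n}"]) (auto simp: mono_sens_blocks_def)

lemma finite_cube [simp]: "finite (cube n)"
  using finite_lists_length_eq[of "UNIV :: bool set" n] by (simp add: cube_def)

lemma cube_nonempty [simp]: "cube n \<noteq> {}"
  using length_replicate[of n True] unfolding cube_def by blast

lemma finite_packing_sizes:
  "finite {card P | P. P \<subseteq> mono_sens_blocks n f x \<and> disjoint P}"
  by (rule finite_subset[of _ "card ` Pow (mono_sens_blocks n f x)"]) auto

lemma mbs_at_ge: "P \<subseteq> mono_sens_blocks n f x \<Longrightarrow> disjoint P \<Longrightarrow> card P \<le> mbs_at n f x"
  unfolding mbs_at_def by (rule Max_ge[OF finite_packing_sizes]) auto

lemma mbs_at_obtains:
  obtains P where "P \<subseteq> mono_sens_blocks n f x" "disjoint P" "card P = mbs_at n f x"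
proof -
  have "mbs_at n f x \<in> {card P | P. P \<subseteq> mono_sens_blocks n f x \<and> disjoint P}"
    unfolding mbs_at_def
    by (rule Max_in[OF finite_packing_sizes]) (auto intro: exI[of _ "{}"] simp: disjoint_def)
  then show ?thesis using that by auto
qed

lemma fmbs_at_bdd:
  "bdd_above {(\<Sum>B\<in>mono_sens_blocks n f x. b B) | b. fmbs_feasible n f x b}"
proof (rule bdd_aboveI)
  fix t assume "t \<in> {(\<Sum>B\<in>mono_sens_blocks n f x. b B) | b. fmbs_feasible n f x b}"
  then obtain b where t: "t = (\<Sum>B\<in>mono_sens_blocks n f x. b B)" and b: "fmbs_feasible n f x b"
    by auto
  show "t \<le> real (card (mono_sens_blocks n f x)) * 1"
    unfolding t by (rule sum_bounded_above) (use b in \<open>auto simp: fmbs_feasible_def\<close>)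
qed

lemma fmbs_feasible_zero: "fmbs_feasible n f x (\<lambda>_. 0)"
  by (simp add: fmbs_feasible_def)

lemma fmbs_at_ge: "fmbs_feasible n f x b \<Longrightarrow> (\<Sum>B\<in>mono_sens_blocks n f x. b B) \<le> fmbs_at n f x"
  unfolding fmbs_at_def by (rule cSup_upper[OF _ fmbs_at_bdd]) auto

lemma fmbs_at_least:
  assumes "\<And>b. fmbs_feasible n f x b \<Longrightarrow> (\<Sum>B\<in>mono_sens_blocks n f x. b B) \<le> C"
  shows "fmbs_at n f x \<le> C"
  unfolding fmbs_at_def by (rule cSup_least) (use assms fmbs_feasible_zero[of n f x] in auto)

lemma fmbs_at_nonneg: "0 \<le> fmbs_at n f x"
  using fmbs_at_ge[OF fmbs_feasible_zero] by simp

lemma fmbs_at_no_blocks: "mono_sens_blocks n f x = {} \<Longrightarrow> fmbs_at n f x \<le> 0"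
  by (rule fmbs_at_least) simp

lemma mono_sens_blocks_cong:
  assumes "\<And>y. y \<in> cube n \<Longrightarrow> f y = g y" "x \<in> cube n"
  shows "mono_sens_blocks n f x = mono_sens_blocks n g x"
  using assms by (auto simp: mono_sens_blocks_def cube_def)

lemma mbs_at_cong:
  assumes "\<And>y. y \<in> cube n \<Longrightarrow> f y = g y" "x \<in> cube n"
  shows "mbs_at n f x = mbs_at n g x"
  using mono_sens_blocks_cong[of n f g x] assms by (simp add: mbs_at_def)

lemma fmbs_at_cong:
  assumes "\<And>y. y \<in> cube n \<Longrightarrow> f y = g y" "x \<in> cube n"
  shows "fmbs_at n f x = fmbs_at n g x"
  using mono_sens_blocks_cong[of n f g x] assms by (simp add: fmbs_at_def fmbs_feasible_def)

section \<open>Maximal sensitivity at a prescribed output value\<close>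

text \<open>The inserted 0 keeps the maximum meaningful when the value \<open>c\<close> is not
  attained.\<close>

definition mbs_val :: "nat \<Rightarrow> (bool list \<Rightarrow> bool) \<Rightarrow> bool \<Rightarrow> nat" where
  "mbs_val n f c = Max (insert 0 (mbs_at n f ` {x \<in> cube n. f x = c}))"

lemma mbs_val_ge: "x \<in> cube n \<Longrightarrow> mbs_at n f x \<le> mbs_val n f (f x)"
  unfolding mbs_val_def by (rule Max_ge) auto

lemma mbs_val_le_mbs: "mbs_val n f c \<le> mbs n f"
  unfolding mbs_val_def mbs_def by (auto intro: Max_ge)

lemma mbs_val_obtains:
  assumes "x \<in> cube n"
  obtains y where "y \<in> cube n" "f y = f x" "mbs_at n f y = mbs_val n f (f x)"
proof -
  have "mbs_val n f (f x) \<in> insert 0 (mbs_at n f ` {y \<in> cube n. f y = f x})"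
    unfolding mbs_val_def by (rule Max_in) auto
  \<comment> \<open>If the maximum is only the inserted 0, then \<open>x\<close> itself attains
    it.\<close>
  moreover have "mbs_at n f x = 0" if "mbs_val n f (f x) = 0"
    using mbs_val_ge[OF assms, of f] that by simp
  ultimately show ?thesis using that assms by fastforce
qed

lemma mbs_val_cong:
  assumes "\<And>y. y \<in> cube n \<Longrightarrow> f y = g y"
  shows "mbs_val n f c = mbs_val n g c"
proof -
  have "mbs_at n f ` {x \<in> cube n. f x = c} = mbs_at n g ` {x \<in> cube n. g x = c}"
    by (rule image_cong) (use assms mbs_at_cong[OF assms] in auto)
  then show ?thesis by (simp add: mbs_val_def)
qed

section \<open>Block sensitivity of compositions\<close>

definition part :: "nat \<Rightarrow> nat \<Rightarrow> bool list \<Rightarrow> bool list" where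
  "part m i x = take m (drop (i * m) x)"

definition part_set :: "nat \<Rightarrow> nat \<Rightarrow> nat set \<Rightarrow> nat set" where
  "part_set m i B = {j. j < m \<and> i * m + j \<in> B}"

definition outer :: "nat \<Rightarrow> nat \<Rightarrow> (bool list \<Rightarrow> bool) \<Rightarrow> bool list \<Rightarrow> bool list" where
  "outer n m g x = map (\<lambda>i. g (part m i x)) [0..<n]"

text \<open>The block induced on the outer function. It may miss parts that \<open>B\<close> meets,
  since \<open>B\<close> can flip bits of a part without changing its inner value.\<close>

definition flipped_parts :: "nat \<Rightarrow> nat \<Rightarrow> (bool list \<Rightarrow> bool) \<Rightarrow> bool list \<Rightarrow> nat set \<Rightarrow> nat set" where
  "flipped_parts n m g x B =
     {i. i < n \<and> g (flip (part m i x) (part_set m i B)) \<noteq> g (part m i x)}"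

lemma bcomp_outer: "bcomp n m f g x = f (outer n m g x)"
  by (simp add: bcomp_def outer_def part_def)

lemma length_outer [simp]: "length (outer n m g x) = n"
  by (simp add: outer_def)

lemma nth_outer [simp]: "i < n \<Longrightarrow> outer n m g x ! i = g (part m i x)"
  by (simp add: outer_def)

lemma part_index_less:
  assumes "i < n" "j < (m::nat)"
  shows "i * m + j < n * m"
proof -
  have "i * m + j < Suc i * m" using assms by simp
  also have "\<dots> \<le> n * m" using assms by (intro mult_le_mono1) simp
  finally show ?thesis .
qed

lemma length_part:
  assumes "length x = n * m" "i < n"
  shows "length (part m i x) = m"
proof -
  have "Suc i * m \<le> n * m" using assms by (intro mult_le_mono1) simp
  then show ?thesis using assms by (simp add: part_def)
qed

lemma nth_part:
  assumes "length x = n * m" "i < n" "j < m"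
  shows "part m i x ! j = x ! (i * m + j)"
  using part_index_less[OF assms(2,3)] assms by (simp add: part_def)

lemma part_flip:
  assumes "length x = n * m" "i < n"
  shows "part m i (flip x B) = flip (part m i x) (part_set m i B)"
proof (rule nth_equalityI)
  show "length (part m i (flip x B)) = length (flip (part m i x) (part_set m i B))"
    using assms by (simp add: length_part[of _ n])
  fix j assume "j < length (part m i (flip x B))"
  then have "j < m" using assms by (simp add: length_part[of _ n])
  then show "part m i (flip x B) ! j = flip (part m i x) (part_set m i B) ! j"
    using assms part_index_less[of i n j m]
    by (simp add: length_part[of _ n] nth_part[of _ n] part_set_def)
qed

lemma outer_flip:
  assumes "length x = n * m"
  shows "outer n m g (flip x B) = flip (outer n m g x) (flipped_parts n m g x B)"
  by (rule nth_equalityI) (auto simp: part_flip[OF assms] flipped_parts_def)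

lemma flipped_parts_sens:
  assumes "x \<in> cube (n * m)" "B \<in> mono_sens_blocks (n * m) (bcomp n m f g) x"
  shows "flipped_parts n m g x B \<in> sens_blocks n f (outer n m g x)"
  using assms
  by (auto simp: mono_sens_blocks_def sens_blocks_def bcomp_outer outer_flip cube_def
      flipped_parts_def)

lemma part_set_sens:
  assumes x: "x \<in> cube (n * m)" and B: "B \<in> mono_sens_blocks (n * m) (bcomp n m f g) x"
    and i: "i \<in> flipped_parts n m g x B"
  shows "part_set m i B \<in> mono_sens_blocks m g (part m i x)"
proof -
  have len: "length x = n * m" and "i < n" using x i by (auto simp: cube_def flipped_parts_def)
  have "part_set m i B \<noteq> {}" using i by (auto simp: flipped_parts_def)
  moreover have "j \<notin> supp (part m i x)" if "j \<in> part_set m i B" for j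
  proof -
    have "j < m" "i * m + j \<in> B" using that by (auto simp: part_set_def)
    then have "\<not> x ! (i * m + j)" 
      using B len part_index_less[OF \<open>i < n\<close>] by (auto simp: mono_sens_blocks_def supp_def)
    then show ?thesis using nth_part[OF len \<open>i < n\<close> \<open>j < m\<close>] by (simp add: supp_def)
  qed
  ultimately show ?thesis using i
    by (auto simp: mono_sens_blocks_def flipped_parts_def part_set_def)
qed

text \<open>The weight of each block is pushed forward to the outer block it induces. For fixed
  \<open>i\<close>, the blocks whose induced block contains \<open>i\<close> restrict to monotone
  sensitive blocks of \<open>g\<close> on part \<open>i\<close>; their weights form a feasible
  solution there, which bounds the load at \<open>i\<close>.\<close>

lemma fractional_packing_outer:
  fixes b :: "nat set \<Rightarrow> real"
  assumes x: "x \<in> cube (n * m)" and b: "fmbs_feasible (n * m) (bcomp n m f g) x b"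
  obtains \<beta> where "\<And>S. 0 \<le> \<beta> S"
    and "\<And>i. i < n \<Longrightarrow> (\<Sum>S | S \<in> sens_blocks n f (outer n m g x) \<and> i \<in> S. \<beta> S)
            \<le> fmbs_at m g (part m i x)"
    and "(\<Sum>B\<in>mono_sens_blocks (n * m) (bcomp n m f g) x. b B)
            = (\<Sum>S\<in>sens_blocks n f (outer n m g x). \<beta> S)"
proof -
  define W where "W = mono_sens_blocks (n * m) (bcomp n m f g) x"
  define FP where "FP = flipped_parts n m g x"
  define SS where "SS = sens_blocks n f (outer n m g x)"
  have finW [simp]: "finite W" and finSS [simp]: "finite SS" by (simp_all add: W_def SS_def)
  have b0: "0 \<le> b B" if "B \<in> W" for B using b that by (auto simp: fmbs_feasible_def W_def)
  have b1: "(\<Sum>B | B \<in> W \<and> q \<in> B. b B) \<le> 1" if "q < n * m" for q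
    using b that by (auto simp: fmbs_feasible_def W_def)
  have FP: "FP B \<in> SS" if "B \<in> W" for B
    using flipped_parts_sens[OF x] that by (simp add: W_def FP_def SS_def)
  define \<beta> where "\<beta> S = (\<Sum>B | B \<in> W \<and> FP B = S. b B)" for S
  show ?thesis
  proof (rule that[of \<beta>])
    show "0 \<le> \<beta> S" for S unfolding \<beta>_def by (rule sum_nonneg) (use b0 in auto)
    show "(\<Sum>B\<in>mono_sens_blocks (n * m) (bcomp n m f g) x. b B)
            = (\<Sum>S\<in>sens_blocks n f (outer n m g x). \<beta> S)"
      unfolding \<beta>_def W_def[symmetric] SS_def[symmetric]
      by (rule sum.group[symmetric]) (use FP in auto)
    fix i assume i: "i < n"
    define V where "V = mono_sens_blocks m g (part m i x)"
    define U where "U = {B \<in> W. i \<in> FP B}"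
    define b' where "b' C = (\<Sum>B | B \<in> U \<and> part_set m i B = C. b B)" for C
    have finU [simp]: "finite U" and UW: "U \<subseteq> W" by (auto simp: U_def)
    have finV [simp]: "finite V" by (simp add: V_def)
    have UV: "part_set m i B \<in> V" if "B \<in> U" for B
      using part_set_sens[OF x] that by (auto simp: U_def V_def W_def FP_def)
    have b'0: "0 \<le> b' C" for C unfolding b'_def by (rule sum_nonneg) (use b0 UW in auto)
    have b'1: "(\<Sum>C | C \<in> V \<and> j \<in> C. b' C) \<le> 1" if j: "j < m" for j
    proof -
      have "(\<Sum>C | C \<in> V \<and> j \<in> C. b' C)
          = (\<Sum>C | C \<in> V \<and> j \<in> C. \<Sum>B | B \<in> {B \<in> U. j \<in> part_set m i B} \<and> part_set m i B = C. b B)"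
        unfolding b'_def by (intro sum.cong refl) auto
      also have "\<dots> = (\<Sum>B | B \<in> U \<and> j \<in> part_set m i B. b B)"
        by (rule sum.group) (use UV in auto)
      \<comment> \<open>A trace on part \<open>i\<close> contains \<open>j\<close> only if the block
        contains the single bit \<open>i * m + j\<close>, whose capacity is 1.\<close>
      also have "\<dots> \<le> (\<Sum>B | B \<in> W \<and> i * m + j \<in> B. b B)"
        by (rule sum_mono2) (use UW b0 in \<open>auto simp: part_set_def\<close>)
      also have "\<dots> \<le> 1" by (rule b1[OF part_index_less[OF i j]])
      finally show ?thesis .
    qed
    \<comment> \<open>The box constraint follows from the capacity at any element of the nonempty
      block \<open>C\<close>.\<close>
    have "b' C \<le> 1" if C: "C \<in> V" for C
    proof -
      obtain j where j: "j \<in> C" "j < m" using C by (auto simp: V_def mono_sens_blocks_def)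
      have "b' C = sum b' {C}" by simp
      also have "\<dots> \<le> (\<Sum>C | C \<in> V \<and> j \<in> C. b' C)"
        by (rule sum_mono2) (use C j b'0 in auto)
      finally show ?thesis using b'1[OF j(2)] by simp
    qed
    then have "fmbs_feasible m g (part m i x) b'"
      using b'0 b'1 by (auto simp: fmbs_feasible_def V_def)
    then have "(\<Sum>C\<in>V. b' C) \<le> fmbs_at m g (part m i x)" unfolding V_def by (rule fmbs_at_ge)
    moreover have "(\<Sum>C\<in>V. b' C) = (\<Sum>B\<in>U. b B)"
      unfolding b'_def by (rule sum.group) (use UV in auto)
    moreover have "(\<Sum>S | S \<in> SS \<and> i \<in> S. \<beta> S)
        = (\<Sum>S | S \<in> SS \<and> i \<in> S. \<Sum>B | B \<in> U \<and> FP B = S. b B)"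
      unfolding \<beta>_def U_def by (intro sum.cong refl) auto
    moreover have "\<dots> = (\<Sum>B\<in>U. b B)"
      by (rule sum.group) (use FP in \<open>auto simp: U_def\<close>)
    ultimately show "(\<Sum>S | S \<in> sens_blocks n f (outer n m g x) \<and> i \<in> S. \<beta> S)
            \<le> fmbs_at m g (part m i x)" by (simp add: SS_def)
  qed
qed

section \<open>Lifting integral packings to the composition\<close>

lemma cube_parts_obtains:
  assumes X: "\<And>i. i < n \<Longrightarrow> X i \<in> cube m"
  obtains x where "x \<in> cube (n * m)" "\<And>i. i < n \<Longrightarrow> part m i x = X i"
proof -
  define x where "x = map (\<lambda>q. X (q div m) ! (q mod m)) [0..<n * m]"
  have lenx: "length x = n * m" by (simp add: x_def)
  have "part m i x = X i" if i: "i < n" for i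
  proof (rule nth_equalityI)
    show "length (part m i x) = length (X i)"
      using X[OF i] by (simp add: length_part[OF lenx i] cube_def)
    fix j assume "j < length (part m i x)"
    then have j: "j < m" by (simp add: length_part[OF lenx i])
    have "part m i x ! j = x ! (i * m + j)" by (rule nth_part[OF lenx i j])
    also have "\<dots> = X i ! j" using part_index_less[OF i j] j by (simp add: x_def)
    finally show "part m i x ! j = X i ! j" .
  qed
  then show ?thesis using that lenx by (simp add: cube_def)
qed

text \<open>Glue inputs \<open>X i\<close> of inner value \<open>z ! i\<close> that attain
  \<open>mbs_val\<close>, each with an optimal packing \<open>P i\<close>. Each of the
  \<open>k S\<close> copies of \<open>S\<close> receives its own member of \<open>P i\<close> for
  every \<open>i\<close> in \<open>S\<close>, which the capacities permit. The unions of the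
  assigned members are disjoint monotone sensitive blocks.\<close>

lemma integral_packing_lift:
  fixes k :: "nat set \<Rightarrow> nat"
  assumes len: "length z = n"
    and attained: "\<And>i. i < n \<Longrightarrow> \<exists>y\<in>cube m. g y = z ! i"
    and cap: "\<And>i. i < n \<Longrightarrow> (\<Sum>S | S \<in> sens_blocks n f z \<and> i \<in> S. k S) \<le> mbs_val m g (z ! i)"
  shows "(\<Sum>S\<in>sens_blocks n f z. k S) \<le> mbs_val (n * m) (bcomp n m f g) (f z)"
proof -
  have "\<exists>X P. X \<in> cube m \<and> g X = z ! i \<and> P \<subseteq> mono_sens_blocks m g X \<and> disjoint P
          \<and> card P = mbs_val m g (z ! i)" if i: "i < n" for i
  proof -
    obtain y where y: "y \<in> cube m" "g y = z ! i" using attained[OF i] by auto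
    obtain X where X: "X \<in> cube m" "g X = z ! i" "mbs_at m g X = mbs_val m g (z ! i)"
      by (rule mbs_val_obtains[OF y(1), of g]) (simp add: y(2))
    obtain P where "P \<subseteq> mono_sens_blocks m g X" "disjoint P" "card P = mbs_at m g X"
      by (rule mbs_at_obtains)
    then show ?thesis using X by auto
  qed
  then obtain X P where X: "\<And>i. i < n \<Longrightarrow> X i \<in> cube m" "\<And>i. i < n \<Longrightarrow> g (X i) = z ! i"
    and P: "\<And>i. i < n \<Longrightarrow> P i \<subseteq> mono_sens_blocks m g (X i)" "\<And>i. i < n \<Longrightarrow> disjoint (P i)"
      "\<And>i. i < n \<Longrightarrow> card (P i) = mbs_val m g (z ! i)"
    by metis
  have finP: "finite (P i)" if "i < n" for i
    using P(1)[OF that] finite_mono_sens_blocks finite_subset by blast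
  obtain x where x: "x \<in> cube (n * m)" and partx: "\<And>i. i < n \<Longrightarrow> part m i x = X i"
    using cube_parts_obtains[of n X m] X(1) by metis
  have lenx: "length x = n * m" using x by (simp add: cube_def)
  have outerx: "outer n m g x = z"
    by (rule nth_equalityI) (auto simp: len partx X)
  \<comment> \<open>\<open>J\<close> indexes the copies: a pair of a block and a copy
    number.\<close>
  define J where "J = Sigma (sens_blocks n f z) (\<lambda>S. {..<k S})"
  have finJ [simp]: "finite J" by (simp add: J_def)
  \<comment> \<open>At most \<open>card (P i)\<close> copies use index \<open>i\<close>, so they can
    be assigned distinct members of \<open>P i\<close>.\<close>
  have "\<exists>\<phi>. \<phi> ` {p \<in> J. i \<in> fst p} \<subseteq> P i \<and> inj_on \<phi> {p \<in> J. i \<in> fst p}" if i: "i < n" for i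
  proof (rule card_le_inj)
    show "finite {p \<in> J. i \<in> fst p}" by simp
    show "finite (P i)" by (rule finP[OF i])
    have "{p \<in> J. i \<in> fst p} = Sigma {S \<in> sens_blocks n f z. i \<in> S} (\<lambda>S. {..<k S})"
      by (auto simp: J_def)
    then have "card {p \<in> J. i \<in> fst p} = (\<Sum>S | S \<in> sens_blocks n f z \<and> i \<in> S. k S)"
      by simp
    then show "card {p \<in> J. i \<in> fst p} \<le> card (P i)" using cap[OF i] P(3)[OF i] by simp
  qed
  then have "\<forall>i. \<exists>h. i < n \<longrightarrow> h ` {p \<in> J. i \<in> fst p} \<subseteq> P i \<and> inj_on h {p \<in> J. i \<in> fst p}"
    by blast
  from choice[OF this] obtain \<phi> where assign: "\<And>i. i < n \<Longrightarrow>
      \<phi> i ` {p \<in> J. i \<in> fst p} \<subseteq> P i \<and> inj_on (\<phi> i) {p \<in> J. i \<in> fst p}"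
    by blast
  have \<phi>: "\<phi> i p \<in> P i" if "i < n" "p \<in> J" "i \<in> fst p" for i p
    using assign[OF that(1)] that by blast
  have inj: "inj_on (\<phi> i) {p \<in> J. i \<in> fst p}" if "i < n" for i
    using assign[OF that] by blast
  \<comment> \<open>Bit \<open>q\<close> of the composed input has offset \<open>q mod m\<close> in
    part \<open>q div m\<close>.\<close>
  define Blk where "Blk p = {q. q < n * m \<and> q div m \<in> fst p \<and> q mod m \<in> \<phi> (q div m) p}" for p
  have \<phi>_sens: "\<phi> i p \<in> mono_sens_blocks m g (X i)" if "i < n" "p \<in> J" "i \<in> fst p" for i p
    using \<phi>[OF that] P(1)[OF that(1)] by auto
  have part_Blk: "part_set m i (Blk p) = (if i \<in> fst p then \<phi> i p else {})"
    if "i < n" "p \<in> J" for i p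
  proof -
    have "j \<in> part_set m i (Blk p) \<longleftrightarrow> j < m \<and> i \<in> fst p \<and> j \<in> \<phi> i p" for j
    proof (cases "j < m")
      case True
      then have "(i * m + j) div m = i" "(i * m + j) mod m = j" by auto
      then show ?thesis
        using True part_index_less[OF that(1) True] by (simp add: part_set_def Blk_def)
    qed (simp add: part_set_def)
    moreover have "\<phi> i p \<subseteq> {..<m}" if "i \<in> fst p"
      using \<phi>_sens[OF \<open>i < n\<close> \<open>p \<in> J\<close> that] by (auto simp: mono_sens_blocks_def)
    ultimately show ?thesis by auto
  qed
  have flipped: "flipped_parts n m g x (Blk p) = fst p" if p: "p \<in> J" for p
  proof -
    have sub: "fst p \<subseteq> {..<n}" using p by (auto simp: J_def sens_blocks_def)
    have "g (flip (X i) (\<phi> i p)) \<noteq> g (X i)" if "i \<in> fst p" for i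
      using \<phi>_sens[OF _ p that] sub that by (auto simp: mono_sens_blocks_def)
    then show ?thesis using sub p by (auto simp: flipped_parts_def partx part_Blk split: if_splits)
  qed
  have Blk_zero: "q \<notin> supp x" if "p \<in> J" "q \<in> Blk p" for p q
  proof -
    have q: "q < n * m" "q div m \<in> fst p" "q mod m \<in> \<phi> (q div m) p"
      using that by (auto simp: Blk_def)
    then have "q div m < n" by (simp add: less_mult_imp_div_less)
    moreover have "q mod m < m" using q(1) by (cases "m = 0") auto
    ultimately show ?thesis
      using \<phi>_sens[OF _ that(1) q(2)] X(1) q nth_part[OF lenx, of "q div m" "q mod m"]
      by (auto simp: supp_def partx mono_sens_blocks_def cube_def)
  qed
  have Blk_ne: "Blk p \<noteq> {}" if p: "p \<in> J" for p
  proof -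
    obtain i where i: "i \<in> fst p" "i < n"
    proof -
      have "fst p \<in> sens_blocks n f z" using p by (auto simp: J_def)
      then have "fst p \<noteq> {}" "fst p \<subseteq> {..<n}"
        using sens_blocks_nonempty by (auto simp: sens_blocks_def)
      then show ?thesis using that by blast
    qed
    have "part_set m i (Blk p) \<noteq> {}"
      using \<phi>_sens[OF i(2) p i(1)] part_Blk[OF i(2) p] i by (auto simp: mono_sens_blocks_def)
    then show ?thesis by (auto simp: part_set_def)
  qed
  have Blk_sens: "Blk p \<in> mono_sens_blocks (n * m) (bcomp n m f g) x" if p: "p \<in> J" for p
  proof -
    have "f (flip z (fst p)) \<noteq> f z" using p by (auto simp: J_def sens_blocks_def)
    then show ?thesis using Blk_ne[OF p] Blk_zero[OF p]
      by (auto simp: mono_sens_blocks_def bcomp_outer outer_flip[OF lenx] flipped[OF p] outerx)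
        (auto simp: Blk_def)
  qed
  have Blk_disj: "Blk p \<inter> Blk r = {}" if pr: "p \<in> J" "r \<in> J" "p \<noteq> r" for p r
  proof (rule ccontr)
    assume "Blk p \<inter> Blk r \<noteq> {}"
    then obtain q where q: "q < n * m" "q div m \<in> fst p" "q mod m \<in> \<phi> (q div m) p"
      "q div m \<in> fst r" "q mod m \<in> \<phi> (q div m) r" by (auto simp: Blk_def)
    then have i: "q div m < n" by (simp add: less_mult_imp_div_less)
    \<comment> \<open>Two copies sharing the bit \<open>q\<close> both use part
      \<open>q div m\<close>, where they were assigned different members of a disjoint
      family.\<close>
    have "\<phi> (q div m) p \<noteq> \<phi> (q div m) r"
      using inj_onD[OF inj[OF i], of p r] pr q by auto
    then show False
      using disjointD[OF P(2)[OF i] \<phi>[OF i pr(1) q(2)] \<phi>[OF i pr(2) q(4)]] q by auto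
  qed
  have "inj_on Blk J"
    by (rule inj_onI) (metis Blk_disj Blk_ne Int_absorb)
  then have "card (Blk ` J) = card J" by (rule card_image)
  also have "\<dots> = (\<Sum>S\<in>sens_blocks n f z. k S)" by (simp add: J_def)
  finally have "(\<Sum>S\<in>sens_blocks n f z. k S) = card (Blk ` J)" by simp
  also have "\<dots> \<le> mbs_at (n * m) (bcomp n m f g) x"
  proof (rule mbs_at_ge)
    show "disjoint (Blk ` J)"
      by (rule disjointI) (use Blk_disj in blast)
  qed (use Blk_sens in auto)
  also have "\<dots> \<le> mbs_val (n * m) (bcomp n m f g) (f z)"
    using mbs_val_ge[of x "n * m" "bcomp n m f g"] lenx by (simp add: cube_def bcomp_outer outerx)
  finally show ?thesis .
qed


section \<open>Rounding fractional packings\<close>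

text \<open>\<open>D\<close> bounds the additive integrality gap of the packing problem at
  \<open>z\<close>, uniformly in the capacities. A capacity depends on \<open>i\<close> only through
  the bit \<open>z ! i\<close>, because part \<open>i\<close> can be chosen freely among the inner
  inputs of that value.\<close>

definition rounds_within :: "nat \<Rightarrow> (bool list \<Rightarrow> bool) \<Rightarrow> bool list \<Rightarrow> real \<Rightarrow> bool" where
  "rounds_within n f z D \<longleftrightarrow>
     (\<forall>(w :: bool \<Rightarrow> nat) (\<beta> :: nat set \<Rightarrow> real).
        (\<forall>S. 0 \<le> \<beta> S) \<longrightarrow>
        (\<forall>i<n. (\<Sum>S | S \<in> sens_blocks n f z \<and> i \<in> S. \<beta> S) \<le> real (w (z ! i))) \<longrightarrow>
        (\<exists>k :: nat set \<Rightarrow> nat.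
           (\<forall>i<n. (\<Sum>S | S \<in> sens_blocks n f z \<and> i \<in> S. k S) \<le> w (z ! i)) \<and>
           (\<Sum>S\<in>sens_blocks n f z. \<beta> S) \<le> real (\<Sum>S\<in>sens_blocks n f z. k S) + D))"

text \<open>Every weight is rounded down; each of at most \<open>2 ^ n\<close> blocks loses at most
  1.\<close>

lemma rounds_within_pow2: "rounds_within n f z (2 ^ n)"
  unfolding rounds_within_def
proof (intro allI impI)
  fix w :: "bool \<Rightarrow> nat" and \<beta> :: "nat set \<Rightarrow> real"
  assume \<beta>: "\<forall>S. 0 \<le> \<beta> S"
    and cap: "\<forall>i<n. (\<Sum>S | S \<in> sens_blocks n f z \<and> i \<in> S. \<beta> S) \<le> real (w (z ! i))"
  define k where "k S = nat \<lfloor>\<beta> S\<rfloor>" for S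
  have k: "real (k S) \<le> \<beta> S" "\<beta> S \<le> real (k S) + 1" for S
    using \<beta> by (auto simp: k_def)
  show "\<exists>k :: nat set \<Rightarrow> nat.
           (\<forall>i<n. (\<Sum>S | S \<in> sens_blocks n f z \<and> i \<in> S. k S) \<le> w (z ! i)) \<and>
           (\<Sum>S\<in>sens_blocks n f z. \<beta> S) \<le> real (\<Sum>S\<in>sens_blocks n f z. k S) + 2 ^ n"
  proof (intro exI[of _ k] conjI allI impI)
    fix i assume "i < n"
    have "real (\<Sum>S | S \<in> sens_blocks n f z \<and> i \<in> S. k S)
        \<le> (\<Sum>S | S \<in> sens_blocks n f z \<and> i \<in> S. \<beta> S)"
      by (simp add: sum_mono k)
    also have "\<dots> \<le> real (w (z ! i))" using cap \<open>i < n\<close> by blast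
    finally show "(\<Sum>S | S \<in> sens_blocks n f z \<and> i \<in> S. k S) \<le> w (z ! i)" by linarith
  next
    have "(\<Sum>S\<in>sens_blocks n f z. \<beta> S) \<le> (\<Sum>S\<in>sens_blocks n f z. real (k S) + 1)"
      by (rule sum_mono) (rule k)
    also have "\<dots> = real (\<Sum>S\<in>sens_blocks n f z. k S) + real (card (sens_blocks n f z))"
      by (simp add: sum.distrib)
    also have "real (card (sens_blocks n f z)) \<le> 2 ^ n"
      using card_sens_blocks_le[of n f z] by (metis of_nat_le_iff of_nat_numeral of_nat_power)
    finally show "(\<Sum>S\<in>sens_blocks n f z. \<beta> S)
        \<le> real (\<Sum>S\<in>sens_blocks n f z. k S) + 2 ^ n" by simp
  qed
qed

text \<open>Every block contains the coordinate of \<open>S0\<close> with the smallest capacity, so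
  that capacity bounds every fractional packing. Taking \<open>S0\<close> that many times attains
  it.\<close>

lemma rounds_within_least_block:
  assumes S0: "S0 \<in> sens_blocks n f z" and least: "\<And>S. S \<in> sens_blocks n f z \<Longrightarrow> S0 \<subseteq> S"
  shows "rounds_within n f z 0"
  unfolding rounds_within_def
proof (intro allI impI)
  fix w :: "bool \<Rightarrow> nat" and \<beta> :: "nat set \<Rightarrow> real"
  assume \<beta>: "\<forall>S. 0 \<le> \<beta> S"
    and cap: "\<forall>i<n. (\<Sum>S | S \<in> sens_blocks n f z \<and> i \<in> S. \<beta> S) \<le> real (w (z ! i))"
  have S0n: "S0 \<subseteq> {..<n}" and "S0 \<noteq> {}" "finite S0"
    using S0 sens_blocks_nonempty[OF S0] finite_subset by (auto simp: sens_blocks_def)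
  define t where "t = Min ((\<lambda>i. w (z ! i)) ` S0)"
  have tle: "t \<le> w (z ! i)" if "i \<in> S0" for i
    unfolding t_def using that \<open>finite S0\<close> by simp
  have "t \<in> (\<lambda>i. w (z ! i)) ` S0"
    unfolding t_def using \<open>finite S0\<close> \<open>S0 \<noteq> {}\<close> by (intro Min_in) auto
  then obtain i0 where i0: "i0 \<in> S0" "t = w (z ! i0)" by auto
  define k where "k S = (if S = S0 then t else 0)" for S
  show "\<exists>k :: nat set \<Rightarrow> nat.
           (\<forall>i<n. (\<Sum>S | S \<in> sens_blocks n f z \<and> i \<in> S. k S) \<le> w (z ! i)) \<and>
           (\<Sum>S\<in>sens_blocks n f z. \<beta> S) \<le> real (\<Sum>S\<in>sens_blocks n f z. k S) + 0"
  proof (intro exI[of _ k] conjI allI impI)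
    fix i assume "i < n"
    show "(\<Sum>S | S \<in> sens_blocks n f z \<and> i \<in> S. k S) \<le> w (z ! i)"
      using tle by (simp add: k_def)
  next
    have "sens_blocks n f z = {S \<in> sens_blocks n f z. i0 \<in> S}"
      using least i0 by auto
    then have "(\<Sum>S\<in>sens_blocks n f z. \<beta> S) = (\<Sum>S | S \<in> sens_blocks n f z \<and> i0 \<in> S. \<beta> S)"
      by simp
    also have "\<dots> \<le> real t" using cap i0 S0n by auto
    also have "t = (\<Sum>S\<in>sens_blocks n f z. k S)" using S0 by (simp add: k_def)
    finally show "(\<Sum>S\<in>sens_blocks n f z. \<beta> S) \<le> real (\<Sum>S\<in>sens_blocks n f z. k S) + 0"
      by simp
  qed
qed

text \<open>The sensitive singletons can each be taken up to full capacity without interfering. Any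
  fractional packing is bounded by the same total, since each block contains a sensitive coordinate
  to which its weight can be charged.\<close>

lemma rounds_within_singletons:
  assumes single: "\<And>S. S \<in> sens_blocks n f z \<Longrightarrow> \<exists>i\<in>S. {i} \<in> sens_blocks n f z"
  shows "rounds_within n f z 0"
  unfolding rounds_within_def
proof (intro allI impI)
  fix w :: "bool \<Rightarrow> nat" and \<beta> :: "nat set \<Rightarrow> real"
  assume \<beta>: "\<forall>S. 0 \<le> \<beta> S"
    and cap: "\<forall>i<n. (\<Sum>S | S \<in> sens_blocks n f z \<and> i \<in> S. \<beta> S) \<le> real (w (z ! i))"
  define SS where "SS = sens_blocks n f z"
  define T where "T = {i. {i} \<in> SS}"
  have Tn: "T \<subseteq> {..<n}" by (auto simp: T_def SS_def sens_blocks_def)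
  then have finT [simp]: "finite T" by (rule finite_subset) simp
  define k where "k S = (if S \<in> (\<lambda>i. {i}) ` T then w (z ! the_elem S) else 0)" for S
  have k0: "k S = 0" if "S \<notin> (\<lambda>i. {i}) ` T" for S using that by (simp add: k_def)
  show "\<exists>k :: nat set \<Rightarrow> nat.
           (\<forall>i<n. (\<Sum>S | S \<in> sens_blocks n f z \<and> i \<in> S. k S) \<le> w (z ! i)) \<and>
           (\<Sum>S\<in>sens_blocks n f z. \<beta> S) \<le> real (\<Sum>S\<in>sens_blocks n f z. k S) + 0"
  proof (intro exI[of _ k] conjI allI impI)
    fix i assume "i < n"
    have "(\<Sum>S | S \<in> SS \<and> i \<in> S. k S) \<le> (\<Sum>S\<in>{{i}}. k S)"
    proof -
      have "(\<Sum>S | S \<in> SS \<and> i \<in> S. k S) = (\<Sum>S\<in>{S \<in> SS. i \<in> S} \<inter> {{i}}. k S)"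
        by (rule sum.mono_neutral_right) (auto simp: SS_def intro!: k0)
      also have "\<dots> \<le> (\<Sum>S\<in>{{i}}. k S)" by (rule sum_mono2) auto
      finally show ?thesis .
    qed
    also have "\<dots> \<le> w (z ! i)" by (simp add: k_def)
    finally show "(\<Sum>S | S \<in> sens_blocks n f z \<and> i \<in> S. k S) \<le> w (z ! i)"
      by (simp add: SS_def)
  next
    have "\<beta> S \<le> (\<Sum>i | i \<in> T \<and> i \<in> S. \<beta> S)" if S: "S \<in> SS" for S
    proof -
      obtain i where "i \<in> T" "i \<in> S" using single[of S] S by (auto simp: SS_def T_def)
      then have "(\<Sum>i\<in>{i}. \<beta> S) \<le> (\<Sum>i | i \<in> T \<and> i \<in> S. \<beta> S)"
        using \<beta> by (intro sum_mono2) auto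
      then show ?thesis by simp
    qed
    then have "(\<Sum>S\<in>SS. \<beta> S) \<le> (\<Sum>S\<in>SS. \<Sum>i | i \<in> T \<and> i \<in> S. \<beta> S)" by (rule sum_mono)
    also have "\<dots> = (\<Sum>i\<in>T. \<Sum>S | S \<in> SS \<and> i \<in> S. \<beta> S)"
      by (rule sum.swap_restrict) (auto simp: SS_def)
    also have "\<dots> \<le> (\<Sum>i\<in>T. real (w (z ! i)))"
      by (rule sum_mono) (use cap Tn in \<open>auto simp: SS_def\<close>)
    also have "\<dots> = real (\<Sum>S\<in>(\<lambda>i. {i}) ` T. k S)"
      by (subst sum.reindex) (auto simp: k_def)
    also have "(\<Sum>S\<in>(\<lambda>i. {i}) ` T. k S) = (\<Sum>S\<in>SS. k S)"
      by (rule sum.mono_neutral_left) (auto simp: SS_def T_def k_def)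
    finally show "(\<Sum>S\<in>sens_blocks n f z. \<beta> S) \<le> real (\<Sum>S\<in>sens_blocks n f z. k S) + 0"
      by (simp add: SS_def)
  qed
qed

section \<open>Exact rounding when one output value has no fork\<close>

text \<open>Disjoint sensitive blocks are distinct because they are nonempty, so this says that some
  input of value \<open>c\<close> has block sensitivity at least 2.\<close>

definition forks :: "nat \<Rightarrow> (bool list \<Rightarrow> bool) \<Rightarrow> bool \<Rightarrow> bool" where
  "forks n f c \<longleftrightarrow> (\<exists>z S T. length z = n \<and> f z = c \<and>
     S \<in> sens_blocks n f z \<and> T \<in> sens_blocks n f z \<and> S \<inter> T = {})"

text \<open>At inputs of value \<open>c\<close> the sensitive blocks are closed under intersection,
  so there is a least one or none at all. At the other inputs every minimal block is a singleton.
  Any failure yields a fork at a neighbouring point of value \<open>c\<close>.\<close>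

lemma rounds_within_not_forks:
  assumes nf: "\<not> forks n f c" and len: "length z = n"
  shows "rounds_within n f z 0"
proof (cases "f z = c")
  case True
  have inter: "S \<inter> T \<in> sens_blocks n f z"
    if S: "S \<in> sens_blocks n f z" and T: "T \<in> sens_blocks n f z" for S T
  proof (rule ccontr)
    let ?y = "flip z (S \<inter> T)"
    assume "S \<inter> T \<notin> sens_blocks n f z"
    then have fy: "f ?y = c" using S True by (auto simp: sens_blocks_def)
    \<comment> \<open>Seen from \<open>?y\<close>, the points reached by \<open>S\<close> and
      \<open>T\<close> lie in the disjoint directions \<open>S - T\<close> and
      \<open>T - S\<close>.\<close>
    have "flip ?y (S - T) = flip z S" "flip ?y (T - S) = flip z T"
      by (auto simp: flip_flip intro!: arg_cong[of _ _ "flip z"])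
    then have "S - T \<in> sens_blocks n f ?y" "T - S \<in> sens_blocks n f ?y"
      using S T fy True by (auto simp: sens_blocks_def)
    moreover have "(S - T) \<inter> (T - S) = {}" by auto
    ultimately show False using nf fy len unfolding forks_def by (metis length_flip)
  qed
  show ?thesis
  proof (cases "sens_blocks n f z = {}")
    case True
    then show ?thesis by (intro rounds_within_singletons) auto
  next
    case False
    then obtain S0 where S0: "S0 \<in> sens_blocks n f z"
      "\<forall>S\<in>sens_blocks n f z. S \<subseteq> S0 \<longrightarrow> S0 = S"
      using finite_has_minimal[of "sens_blocks n f z"] by auto
    show ?thesis
      \<comment> \<open>For any block \<open>S\<close>, the sensitive block formed by its
        intersection with \<open>S0\<close> equals \<open>S0\<close> by minimality.\<close>
      by (rule rounds_within_least_block[OF S0(1)]) (use S0 inter in blast)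
  qed
next
  case False
  show ?thesis
  proof (rule rounds_within_singletons)
    fix S assume S: "S \<in> sens_blocks n f z"
    let ?A = "{S' \<in> sens_blocks n f z. S' \<subseteq> S}"
    obtain M where M: "M \<in> sens_blocks n f z" "M \<subseteq> S"
      and minM: "\<And>S'. S' \<in> sens_blocks n f z \<Longrightarrow> S' \<subseteq> M \<Longrightarrow> S' = M"
    proof -
      have "finite ?A" "?A \<noteq> {}" using S by auto
      from finite_has_minimal[OF this] obtain M where "M \<in> ?A" "\<forall>S'\<in>?A. S' \<subseteq> M \<longrightarrow> M = S'"
        by auto
      then show ?thesis by (intro that[of M]) auto
    qed
    obtain i where i: "i \<in> M" using sens_blocks_nonempty[OF M(1)] by auto
    have "M = {i}"
    proof (rule ccontr)
      assume ne: "M \<noteq> {i}"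
      let ?y = "flip z M"
      have sub: "M \<subseteq> {..<n}" using M by (auto simp: sens_blocks_def)
      have fy: "f ?y = c" using M False by (auto simp: sens_blocks_def)
      \<comment> \<open>Both are proper subsets of the minimal block \<open>M\<close>, so flipping
        either keeps the value of \<open>z\<close>, which differs from that of
        \<open>?y\<close>.\<close>
      have "{i} \<notin> sens_blocks n f z" "M - {i} \<notin> sens_blocks n f z"
        using minM[of "{i}"] minM[of "M - {i}"] i ne by auto
      then have "f (flip z {i}) \<noteq> c" "f (flip z (M - {i})) \<noteq> c"
        using sub i False by (auto simp: sens_blocks_def)
      moreover have "flip ?y {i} = flip z (M - {i})" "flip ?y (M - {i}) = flip z {i}"
        using i by (auto simp: flip_flip intro!: arg_cong[of _ _ "flip z"])
      ultimately have "{i} \<in> sens_blocks n f ?y" "M - {i} \<in> sens_blocks n f ?y"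
        using sub i fy by (auto simp: sens_blocks_def)
      moreover have "{i} \<inter> (M - {i}) = {}" by auto
      ultimately show False using nf fy len unfolding forks_def by (metis length_flip)
    qed
    then show "\<exists>i\<in>S. {i} \<in> sens_blocks n f z" using M by auto
  qed
qed

section \<open>One step of the recursion\<close>

text \<open>Dividing the induced outer packing by \<open>R\<close> makes it fit the integral
  capacities; it is then rounded and lifted. Multiplying back by \<open>R\<close> also scales the
  loss \<open>D\<close>.\<close>

lemma fmbs_at_bcomp_le:
  fixes R D :: real
  assumes R: "0 < R"
    and IH: "\<And>y. y \<in> cube m \<Longrightarrow> fmbs_at m g y \<le> R * real (mbs_val m g (g y))"
    and round: "rounds_within n f (outer n m g x) D"
    and x: "x \<in> cube (n * m)"
  shows "fmbs_at (n * m) (bcomp n m f g) x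
    \<le> R * (real (mbs_val (n * m) (bcomp n m f g) (bcomp n m f g x)) + D)"
proof (rule fmbs_at_least)
  fix b assume b: "fmbs_feasible (n * m) (bcomp n m f g) x b"
  let ?z = "outer n m g x"
  have part_cube: "part m i x \<in> cube m" if "i < n" for i
    using length_part[of x n m i] x that by (simp add: cube_def)
  obtain \<beta> where \<beta>: "\<And>S. 0 \<le> \<beta> S"
    and cap: "\<And>i. i < n \<Longrightarrow> (\<Sum>S | S \<in> sens_blocks n f ?z \<and> i \<in> S. \<beta> S)
            \<le> fmbs_at m g (part m i x)"
    and tot: "(\<Sum>B\<in>mono_sens_blocks (n * m) (bcomp n m f g) x. b B)
            = (\<Sum>S\<in>sens_blocks n f ?z. \<beta> S)"
    by (rule fractional_packing_outer[OF x b]) (rule that)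
  have "(\<Sum>S | S \<in> sens_blocks n f ?z \<and> i \<in> S. \<beta> S / R) \<le> real (mbs_val m g (?z ! i))"
    if i: "i < n" for i
  proof -
    have "(\<Sum>S | S \<in> sens_blocks n f ?z \<and> i \<in> S. \<beta> S) \<le> R * real (mbs_val m g (?z ! i))"
      using cap[OF i] IH[OF part_cube[OF i]] i by simp
    then show ?thesis using R by (simp add: sum_divide_distrib[symmetric] divide_le_eq mult.commute)
  qed
  then obtain k :: "nat set \<Rightarrow> nat" where
    k: "\<forall>i<n. (\<Sum>S | S \<in> sens_blocks n f ?z \<and> i \<in> S. k S) \<le> mbs_val m g (?z ! i)"
    and le: "(\<Sum>S\<in>sens_blocks n f ?z. \<beta> S / R) \<le> real (\<Sum>S\<in>sens_blocks n f ?z. k S) + D"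
    using round[unfolded rounds_within_def, rule_format, of "\<lambda>S. \<beta> S / R" "mbs_val m g"] \<beta> R
    by auto
  have "(\<Sum>S\<in>sens_blocks n f ?z. k S) \<le> mbs_val (n * m) (bcomp n m f g) (f ?z)"
    by (rule integral_packing_lift) (use k part_cube in auto)
  then have "real (\<Sum>S\<in>sens_blocks n f ?z. k S)
      \<le> real (mbs_val (n * m) (bcomp n m f g) (bcomp n m f g x))"
    by (simp only: of_nat_le_iff bcomp_outer)
  with le have "(\<Sum>S\<in>sens_blocks n f ?z. \<beta> S) / R
      \<le> real (mbs_val (n * m) (bcomp n m f g) (bcomp n m f g x)) + D"
    unfolding sum_divide_distrib by linarith
  then show "(\<Sum>B\<in>mono_sens_blocks (n * m) (bcomp n m f g) x. b B)
    \<le> R * (real (mbs_val (n * m) (bcomp n m f g) (bcomp n m f g x)) + D)"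
    using R unfolding tot by (simp add: divide_le_eq mult.commute)
qed

section \<open>Iterated composition\<close>

text \<open>The recursion is extended down to exponent 0, where \<open>hd\<close> is the identity on
  one bit. Inductions can thus start at \<open>l = 0\<close>.\<close>

lemma bpow_Suc_eq:
  assumes "x \<in> cube (n * n ^ l)"
  shows "bpow n f (Suc l) x = bcomp n (n ^ l) f (bpow n f l) x"
proof (cases l)
  case 0
  have "map (\<lambda>i. hd (take 1 (drop i x))) [0..<n] = x"
    by (rule nth_equalityI) (use assms 0 in \<open>auto simp: cube_def take_Suc hd_drop_conv_nth\<close>)
  then show ?thesis by (simp add: bcomp_def 0)
qed simp

lemma fmbs_at_bpow_Suc_le:
  fixes R D :: real
  assumes "0 < R"
    and "\<And>y. y \<in> cube (n ^ l) \<Longrightarrow>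
      fmbs_at (n ^ l) (bpow n f l) y \<le> R * real (mbs_val (n ^ l) (bpow n f l) (bpow n f l y))"
    and "\<And>z. length z = n \<Longrightarrow> rounds_within n f z D"
    and x: "x \<in> cube (n ^ Suc l)"
  shows "fmbs_at (n ^ Suc l) (bpow n f (Suc l)) x
    \<le> R * (real (mbs_val (n ^ Suc l) (bpow n f (Suc l)) (bpow n f (Suc l) x)) + D)"
  using fmbs_at_bcomp_le[OF assms(1,2), where x=x and n=n and f=f and D=D] assms(3) x
    fmbs_at_cong[OF bpow_Suc_eq] mbs_val_cong[OF bpow_Suc_eq] bpow_Suc_eq[of x]
  by (simp del: bpow.simps)

lemma mono_sens_blocks_hd_True: "mono_sens_blocks 1 hd [True] = {}"
  by (auto simp: mono_sens_blocks_def supp_def)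

lemma mono_sens_blocks_hd_False: "mono_sens_blocks 1 hd [False] = {{0}}"
proof -
  have "flip [False] {0} = [True]" by (simp add: flip_def)
  then show ?thesis by (auto simp: mono_sens_blocks_def supp_def)
qed

lemma mbs_val_hd_False: "1 \<le> mbs_val 1 hd False"
proof -
  have "card {{0::nat}} \<le> mbs_at 1 hd [False]"
    by (rule mbs_at_ge) (simp_all add: mono_sens_blocks_hd_False del: One_nat_def)
  also have "\<dots> \<le> mbs_val 1 hd False" using mbs_val_ge[of "[False]" 1 hd] by (simp add: cube_def)
  finally show ?thesis by simp
qed

lemma cube_1: "x \<in> cube 1 \<longleftrightarrow> x = [True] \<or> x = [False]"
  by (auto simp: cube_def length_Suc_conv)

text \<open>Base case with ratio 1: \<open>[True]\<close> has no block, and \<open>[False]\<close>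
  has a single one, of weight at most 1.\<close>

lemma fmbs_at_hd_le:
  assumes "x \<in> cube 1"
  shows "fmbs_at 1 hd x \<le> real (mbs_val 1 hd (hd x))"
proof -
  consider "x = [True]" | "x = [False]" using assms cube_1 by auto
  then show ?thesis
  proof cases
    case 1
    then show ?thesis
      using fmbs_at_no_blocks[OF mono_sens_blocks_hd_True] by (simp add: order_trans[of _ 0])
  next
    case 2
    have "fmbs_at 1 hd [False] \<le> 1"
      by (rule fmbs_at_least)
        (simp add: fmbs_feasible_def mono_sens_blocks_hd_False del: One_nat_def)
    then show ?thesis using 2 mbs_val_hd_False by simp
  qed
qed

text \<open>Every outer rounding is exact, so the ratio 1 of the base case persists.\<close>

lemma fmbs_at_bpow_not_forks:
  assumes "\<not> forks n f c" "x \<in> cube (n ^ l)"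
  shows "fmbs_at (n ^ l) (bpow n f l) x \<le> real (mbs_val (n ^ l) (bpow n f l) (bpow n f l x))"
  using assms(2)
proof (induction l arbitrary: x)
  case 0
  then show ?case using fmbs_at_hd_le by simp
next
  case (Suc l)
  show ?case
    using fmbs_at_bpow_Suc_le[where R=1 and D=0, OF _ _ rounds_within_not_forks[OF assms(1)]] Suc
    by (simp del: bpow.simps)
qed

section \<open>Growth of monotone block sensitivity\<close>

lemma bpow_attained:
  assumes "\<And>c. \<exists>z. length z = n \<and> f z = c"
  shows "\<exists>y\<in>cube (n ^ l). bpow n f l y = c"
proof (induction l arbitrary: c)
  case 0
  show ?case by (rule bexI[of _ "[c]"]) (auto simp: cube_def)
next
  case (Suc l)
  obtain z where z: "length z = n" "f z = c" using assms by auto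
  obtain Y where Y: "\<And>c. Y c \<in> cube (n ^ l)" "\<And>c. bpow n f l (Y c) = c" using Suc by metis
  obtain x where x: "x \<in> cube (n * n ^ l)" "\<And>i. i < n \<Longrightarrow> part (n ^ l) i x = Y (z ! i)"
    using cube_parts_obtains[of n "\<lambda>i. Y (z ! i)"] Y by metis
  have "outer n (n ^ l) (bpow n f l) x = z"
    by (rule nth_equalityI) (auto simp: z x Y)
  then have "bpow n f (Suc l) x = c" using bpow_Suc_eq[OF x(1)] z by (simp add: bcomp_outer)
  then show ?case using x by auto
qed

text \<open>Take every member of \<open>Q\<close> with multiplicity \<open>t\<close>. By
  disjointness each index is loaded by at most one member, so the load is at most
  \<open>t\<close>.\<close>

lemma mbs_val_bpow_Suc_ge:
  assumes att: "\<And>c. \<exists>z. length z = n \<and> f z = c"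
    and z: "length z = n"
    and Q: "Q \<subseteq> sens_blocks n f z" "disjoint Q"
    and t: "\<And>i. i \<in> \<Union>Q \<Longrightarrow> t \<le> mbs_val (n ^ l) (bpow n f l) (z ! i)"
  shows "card Q * t \<le> mbs_val (n ^ Suc l) (bpow n f (Suc l)) (f z)"
proof -
  define k where "k S = (if S \<in> Q then t else 0)" for S
  have finQ: "finite Q" using Q finite_sens_blocks finite_subset by blast
  have "(\<Sum>S\<in>sens_blocks n f z. k S) \<le> mbs_val (n * n ^ l) (bcomp n (n ^ l) f (bpow n f l)) (f z)"
  proof (rule integral_packing_lift[OF z])
    fix i assume "i < n"
    show "\<exists>y\<in>cube (n ^ l). bpow n f l y = z ! i" by (rule bpow_attained[OF att])
    have eq: "(\<Sum>S | S \<in> sens_blocks n f z \<and> i \<in> S. k S) = (\<Sum>S | S \<in> Q \<and> i \<in> S. t)"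
      using Q(1) by (intro sum.mono_neutral_cong_right) (auto simp: k_def)
    show "(\<Sum>S | S \<in> sens_blocks n f z \<and> i \<in> S. k S) \<le> mbs_val (n ^ l) (bpow n f l) (z ! i)"
    proof (cases "\<exists>S\<in>Q. i \<in> S")
      case True
      then obtain S where S: "S \<in> Q" "i \<in> S" by auto
      then have "{S. S \<in> Q \<and> i \<in> S} = {S}" using disjointD[OF Q(2)] by blast
      then show ?thesis using eq t[of i] S by auto
    next
      case False
      then have "{S. S \<in> Q \<and> i \<in> S} = {}" by auto
      then show ?thesis unfolding eq by (simp only:) simp
    qed
  qed
  moreover have "(\<Sum>S\<in>sens_blocks n f z. k S) = (\<Sum>S\<in>Q. t)"
    using Q(1) by (intro sum.mono_neutral_cong_right) (auto simp: k_def)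
  ultimately show ?thesis using mbs_val_cong[OF bpow_Suc_eq] by (simp del: bpow.simps)
qed

section \<open>Pure steps and doubling of the sensitivity\<close>

text \<open>Such a block draws only on inner inputs of value \<open>a\<close>, so a lower bound on
  \<open>mbs_val\<close> at \<open>a\<close> passes to \<open>c\<close> at the next iterate.\<close>

definition pure_step :: "nat \<Rightarrow> (bool list \<Rightarrow> bool) \<Rightarrow> bool \<Rightarrow> bool \<Rightarrow> bool" where
  "pure_step n f a c \<longleftrightarrow>
     (\<exists>z S. length z = n \<and> f z = c \<and> S \<in> sens_blocks n f z \<and> (\<forall>i\<in>S. z ! i = a))"

text \<open>The same block, read from its other end \<open>flip z S\<close>, has complemented bits
  and output.\<close>

lemma pure_step_reverse:
  assumes "pure_step n f a c"
  shows "pure_step n f (\<not> a) (\<not> c)"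
proof -
  obtain z S where zS: "length z = n" "f z = c" "S \<in> sens_blocks n f z" "\<forall>i\<in>S. z ! i = a"
    using assms by (auto simp: pure_step_def)
  have "flip (flip z S) S = z" by (simp add: flip_flip)
  then show ?thesis unfolding pure_step_def
    by (intro exI[of _ "flip z S"] exI[of _ S]) (use zS in \<open>auto simp: sens_blocks_def subset_iff\<close>)
qed

text \<open>Flip the bits of \<open>S\<close> equal to \<open>a\<close> first. If the value did not
  change yet, the remaining bits would form a pure sensitive block of the excluded kind at the new
  point.\<close>

lemma sens_blocks_shrink:
  assumes np: "\<not> pure_step n f (\<not> a) (f z)" and len: "length z = n"
    and S: "S \<in> sens_blocks n f z"
  shows "{i \<in> S. z ! i = a} \<in> sens_blocks n f z"
proof (rule ccontr)
  let ?A = "{i \<in> S. z ! i = a}" and ?B = "{i \<in> S. z ! i \<noteq> a}"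
  assume "?A \<notin> sens_blocks n f z"
  then have fA: "f (flip z ?A) = f z" using S by (auto simp: sens_blocks_def)
  have Sn: "S \<subseteq> {..<n}" using S by (auto simp: sens_blocks_def)
  have "flip (flip z ?A) ?B = flip z S"
    by (subst flip_flip_disjoint) (auto intro!: arg_cong[of _ _ "flip z"])
  then have "?B \<in> sens_blocks n f (flip z ?A)" using S fA by (auto simp: sens_blocks_def)
  moreover have "\<forall>i\<in>?B. flip z ?A ! i = (\<not> a)" using Sn len by auto
  ultimately have "pure_step n f (\<not> a) (f z)"
    unfolding pure_step_def using fA len
    by (intro exI[of _ "flip z ?A"] exI[of _ ?B]) simp
  then show False using np by simp
qed

text \<open>If only one kind of pure step occurs then \<open>f\<close> is monotone (\<open>d = False\<close>) or antitone
  (\<open>d = True\<close>), and the monotone sensitive blocks of each iterate sit at a single output value.\<close>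

lemma bpow_growth_unate:
  assumes forks: "\<And>c. forks n f c" and un: "\<And>c. \<not> pure_step n f (c = d) c"
  shows "\<exists>a. 2 ^ l \<le> mbs_val (n ^ l) (bpow n f l) a \<and>
    (\<forall>x\<in>cube (n ^ l). bpow n f l x = (\<not> a) \<longrightarrow> mono_sens_blocks (n ^ l) (bpow n f l) x = {})"
proof (induction l)
  case 0
  show ?case
    unfolding bpow.simps power_0
    using mbs_val_hd_False mono_sens_blocks_hd_True
    by (intro exI[of _ False]) (auto simp: cube_1 simp del: One_nat_def)
next
  case (Suc l)
  let ?m = "n ^ l" and ?g = "bpow n f l"
  obtain a where a: "2 ^ l \<le> mbs_val ?m ?g a"
    "\<And>x. x \<in> cube ?m \<Longrightarrow> ?g x = (\<not> a) \<Longrightarrow> mono_sens_blocks ?m ?g x = {}" using Suc by auto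
  have att: "\<exists>z. length z = n \<and> f z = c" for c using forks[of c] by (auto simp: forks_def)
  have shrink: "{i \<in> S. z ! i = (f z \<noteq> d)} \<in> sens_blocks n f z"
    if "length z = n" "S \<in> sens_blocks n f z" for z S
    by (rule sens_blocks_shrink) (use un[of "f z"] that in auto)
  show ?case
  \<comment> \<open>The distinguished value is kept in the monotone case and complemented in the
    antitone case.\<close>
  proof (intro exI[of _ "a \<noteq> d"] conjI ballI impI)
    obtain z S T where z: "length z = n" "f z = (a \<noteq> d)"
      and ST: "S \<in> sens_blocks n f z" "T \<in> sens_blocks n f z" "S \<inter> T = {}"
      using forks[of "a \<noteq> d"] unfolding forks_def by auto
    let ?S = "{i \<in> S. z ! i = a}" and ?T = "{i \<in> T. z ! i = a}"
    have "(f z \<noteq> d) = a" using z by auto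
    then have S': "?S \<in> sens_blocks n f z" "?T \<in> sens_blocks n f z"
      using shrink[OF z(1)] ST by auto
    have disj: "?S \<inter> ?T = {}" using ST by auto
    have ne: "?S \<noteq> ?T" using disj sens_blocks_nonempty[OF S'(1)] by auto
    \<comment> \<open>The two disjoint shrunken blocks use only inner values \<open>a\<close>, so
      the bound doubles.\<close>
    have "card {?S, ?T} * 2 ^ l \<le> mbs_val (n ^ Suc l) (bpow n f (Suc l)) (f z)"
      by (rule mbs_val_bpow_Suc_ge[OF att z(1)]) (use S' disj a(1) in \<open>auto simp: disjoint_def\<close>)
    then show "2 ^ Suc l \<le> mbs_val (n ^ Suc l) (bpow n f (Suc l)) (a \<noteq> d)"
      using ne z by (simp del: bpow.simps)
  next
    fix x assume x: "x \<in> cube (n ^ Suc l)" and fx: "bpow n f (Suc l) x = (\<not> (a \<noteq> d))"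
    let ?z = "outer n ?m ?g x"
    have x': "x \<in> cube (n * ?m)" using x by simp
    have fz: "f ?z = (a = d)" using bpow_Suc_eq[OF x', of f] fx by (simp add: bcomp_outer)
    have "B \<notin> mono_sens_blocks (n * ?m) (bcomp n ?m f ?g) x" for B
    proof
      assume B: "B \<in> mono_sens_blocks (n * ?m) (bcomp n ?m f ?g) x"
      let ?F = "flipped_parts n ?m ?g x B"
      \<comment> \<open>At this output value the shrunken block keeps only bits equal to
        \<open>\<not> a\<close>, but parts of that inner value have no monotone sensitive
        block.\<close>
      have "{i \<in> ?F. ?z ! i = (f ?z \<noteq> d)} \<noteq> {}"
        by (rule sens_blocks_nonempty[OF shrink]) (use flipped_parts_sens[OF x' B] in auto)
      then obtain i where i: "i \<in> ?F" "?z ! i = (\<not> a)" using fz by auto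
      have "i < n" using i by (simp add: flipped_parts_def)
      then have "part ?m i x \<in> cube ?m" "?g (part ?m i x) = (\<not> a)"
        using x' i length_part[of x n ?m i] by (auto simp: cube_def)
      then show False using a(2) part_set_sens[OF x' B i(1)] by auto
    qed
    then show "mono_sens_blocks (n ^ Suc l) (bpow n f (Suc l)) x = {}"
      using mono_sens_blocks_cong[OF bpow_Suc_eq x'] by (auto simp del: bpow.simps)
  qed
qed

text \<open>Pure steps from \<open>False\<close> make both values positive at exponent 1. From then
  on both satisfy the bound, so any fork doubles it whatever bits its blocks contain.\<close>

lemma bpow_growth_mixed:
  assumes forks: "\<And>c. forks n f c" and steps: "\<And>a c. pure_step n f a c"
  shows "2 ^ l \<le> mbs_val (n ^ Suc l) (bpow n f (Suc l)) c"
proof (induction l arbitrary: c)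
  have att: "\<exists>z. length z = n \<and> f z = c" for c using forks[of c] by (auto simp: forks_def)
  {
    case 0
    obtain z S where z: "length z = n" "f z = c" and S: "S \<in> sens_blocks n f z"
      "\<forall>i\<in>S. z ! i = False"
      using steps[of False c] unfolding pure_step_def by blast
    have "card {S} * 1 \<le> mbs_val (n ^ Suc 0) (bpow n f (Suc 0)) (f z)"
      by (rule mbs_val_bpow_Suc_ge[OF att z(1)]) (use S mbs_val_hd_False in auto)
    then show ?case using z by simp
  next
    case (Suc l)
    obtain z S T where z: "length z = n" "f z = c"
      and ST: "S \<in> sens_blocks n f z" "T \<in> sens_blocks n f z" "S \<inter> T = {}"
      using forks[of c] unfolding forks_def by auto
    have ne: "S \<noteq> T" using ST sens_blocks_nonempty[OF ST(1)] by auto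
    have "card {S, T} * 2 ^ l \<le> mbs_val (n ^ Suc (Suc l)) (bpow n f (Suc (Suc l))) (f z)"
      by (rule mbs_val_bpow_Suc_ge[OF att z(1)]) (use ST Suc in \<open>auto simp: disjoint_def\<close>)
    then show ?case using z ne by (simp del: bpow.simps)
  }
qed

lemma bpow_growth:
  assumes forks: "\<And>c. forks n f c" and x: "x \<in> cube (n ^ Suc l)"
  shows "mono_sens_blocks (n ^ Suc l) (bpow n f (Suc l)) x = {} \<or>
    2 ^ l \<le> mbs_val (n ^ Suc l) (bpow n f (Suc l)) (bpow n f (Suc l) x)"
proof (cases "\<forall>a c. pure_step n f a c")
  case True
  then show ?thesis using bpow_growth_mixed[OF forks] by blast
next
  case False
  then obtain a c where ac: "\<not> pure_step n f a c" by auto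
  \<comment> \<open>A missing step is missing together with its reverse; this is the unate case with
    \<open>d\<close> equal to \<open>c = a\<close>.\<close>
  have "\<not> pure_step n f (c' = (c = a)) c'" for c'
    using ac pure_step_reverse[of n f "\<not> a" "\<not> c"] by (cases c'; cases c; cases a) auto
  from bpow_growth_unate[OF forks this, of "Suc l"] obtain b where
    b: "2 ^ Suc l \<le> mbs_val (n ^ Suc l) (bpow n f (Suc l)) b"
    "\<And>x. x \<in> cube (n ^ Suc l) \<Longrightarrow> bpow n f (Suc l) x = (\<not> b) \<Longrightarrow>
       mono_sens_blocks (n ^ Suc l) (bpow n f (Suc l)) x = {}" by blast
  show ?thesis
  proof (cases "bpow n f (Suc l) x = b")
    case True
    have "(2::nat) ^ l \<le> 2 ^ Suc l" by simp
    then show ?thesis using order_trans[OF _ b(1)] unfolding True by blast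
  next
    case False
    then show ?thesis using b(2)[OF x] by blast
  qed
qed

section \<open>Accumulating the rounding losses\<close>

text \<open>The factor \<open>2 - 2 / 2 ^ l\<close> is the sum of \<open>1 / 2 ^ j\<close> over
  \<open>j < l\<close>: passing from exponent \<open>j\<close> to \<open>Suc j\<close> costs a
  factor of at most \<open>exp (2 ^ n / 2 ^ j)\<close>.\<close>

lemma fmbs_at_bpow_forks:
  assumes forks: "\<And>c. forks n f c" and x: "x \<in> cube (n ^ l)"
  shows "fmbs_at (n ^ l) (bpow n f l) x
    \<le> exp (2 ^ n * (2 - 2 / 2 ^ l)) * real (mbs_val (n ^ l) (bpow n f l) (bpow n f l x))"
  using x
proof (induction l arbitrary: x)
  case 0
  then show ?case using fmbs_at_hd_le by simp
next
  case (Suc l)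
  let ?R = "\<lambda>l. exp (2 ^ n * (2 - 2 / 2 ^ l)) :: real"
  let ?F = "fmbs_at (n ^ Suc l) (bpow n f (Suc l)) x"
  let ?w = "real (mbs_val (n ^ Suc l) (bpow n f (Suc l)) (bpow n f (Suc l) x))"
  show ?case
  proof (cases "mono_sens_blocks (n ^ Suc l) (bpow n f (Suc l)) x = {}")
    case True
    have "?F \<le> 0" by (rule fmbs_at_no_blocks[OF True])
    also have "0 \<le> ?R (Suc l) * ?w" by simp
    finally show ?thesis .
  next
    case False
    then have "2 ^ l \<le> mbs_val (n ^ Suc l) (bpow n f (Suc l)) (bpow n f (Suc l) x)"
      using bpow_growth[OF forks Suc.prems] by blast
    then have w: "2 ^ l \<le> ?w" by (metis of_nat_le_iff of_nat_numeral of_nat_power)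
    have "?F \<le> ?R l * (?w + 2 ^ n)"
      by (rule fmbs_at_bpow_Suc_le[OF exp_gt_zero Suc.IH rounds_within_pow2 Suc.prems])
    \<comment> \<open>Since \<open>?w\<close> is at least \<open>2 ^ l\<close>, the additive loss
      \<open>2 ^ n\<close> is a relative loss of at most \<open>2 ^ n / 2 ^ l\<close>.\<close>
    also have "\<dots> \<le> ?R l * ((1 + 2 ^ n / 2 ^ l) * ?w)"
    proof (rule mult_left_mono)
      have "2 ^ n = 2 ^ n / 2 ^ l * (2 ^ l :: real)" by simp
      also have "\<dots> \<le> 2 ^ n / 2 ^ l * ?w" by (rule mult_left_mono[OF w]) simp
      finally show "?w + 2 ^ n \<le> (1 + 2 ^ n / 2 ^ l) * ?w" by (simp add: distrib_right)
    qed simp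
    also have "\<dots> \<le> ?R l * (exp (2 ^ n / 2 ^ l) * ?w)"
      by (intro mult_left_mono mult_right_mono exp_ge_add_one_self) simp_all
    also have "\<dots> = ?R (Suc l) * ?w"
    proof -
      have "2 ^ n * (2 - 2 / 2 ^ l) + 2 ^ n / 2 ^ l = (2 ^ n * (2 - 2 / 2 ^ Suc l) :: real)"
        by (simp add: field_simps)
      then show ?thesis by (metis exp_add mult.assoc)
    qed
    finally show ?thesis .
  qed
qed

theorem theorem1:
  "\<exists>p :: nat \<Rightarrow> real. \<exists>N. \<forall>n\<ge>N. \<forall>f :: bool list \<Rightarrow> bool. \<forall>l\<ge>1.
     fmbs (n ^ l) (bpow n f l) \<le> p n * real (mbs (n ^ l) (bpow n f l)) \<and>
     (mbs (n ^ l) (bpow n f l) = 0 \<longrightarrow> fmbs (n ^ l) (bpow n f l) = 0)"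
\<comment> \<open>The constant is the limit of the accumulated factors as \<open>l\<close> grows;
  the threshold is 0.\<close>
proof (intro exI[of _ "\<lambda>n. exp (2 ^ n * 2)"] exI[of _ 0] allI impI)
  fix n l :: nat and f :: "bool list \<Rightarrow> bool"
  let ?m = "n ^ l" and ?g = "bpow n f l"
  have "fmbs_at ?m ?g x \<le> exp (2 ^ n * 2) * real (mbs ?m ?g)" if x: "x \<in> cube ?m" for x
  proof -
    obtain R :: real where R: "fmbs_at ?m ?g x \<le> R * real (mbs_val ?m ?g (?g x))"
      "0 \<le> R" "R \<le> exp (2 ^ n * 2)"
    proof (cases "\<forall>c. forks n f c")
      case True
      then have "fmbs_at ?m ?g x
          \<le> exp (2 ^ n * (2 - 2 / 2 ^ l)) * real (mbs_val ?m ?g (?g x))"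
        by (intro fmbs_at_bpow_forks[OF _ x]) blast
      then show ?thesis by (rule that) simp_all
    next
      case False
      then obtain c where "\<not> forks n f c" by auto
      then show ?thesis using fmbs_at_bpow_not_forks[OF _ x] that[of 1] by auto
    qed
    note R(1)
    also have "R * real (mbs_val ?m ?g (?g x)) \<le> exp (2 ^ n * 2) * real (mbs ?m ?g)"
      by (rule mult_mono) (use R mbs_val_le_mbs in auto)
    finally show ?thesis .
  qed
  then have le: "fmbs ?m ?g \<le> exp (2 ^ n * 2) * real (mbs ?m ?g)"
    unfolding fmbs_def by (subst Max_le_iff) auto
  \<comment> \<open>Together with the upper bound this settles the case of vanishing
    \<open>mbs\<close>.\<close>
  moreover have "0 \<le> fmbs ?m ?g"
    unfolding fmbs_def using fmbs_at_nonneg by (subst Max_ge_iff) (use cube_nonempty in fastforce)+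
  ultimately show "fmbs ?m ?g \<le> exp (2 ^ n * 2) * real (mbs ?m ?g) \<and>
     (mbs ?m ?g = 0 \<longrightarrow> fmbs ?m ?g = 0)" by auto
qed

end
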